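(* Let $T$ be a finite tree of order $n \ge 4$ that has a redundant identifying code. Then $\mathrm{RED{:}IC}(T) = n$ if and only if every vertex $v \in V(T)$ satisfies at least one of the following: (1) $v$ is a leaf; (2) $v$ is a support vertex; (3) $v$ is adjacent to a support vertex of degree $3$; (4) there is a path $v w u$ in $T$ (with $w$ adjacent to both $v$ and $u$, $u \ne v$) such that $\deg(w) = \deg(u) = 2$.
   Context: $N[v]$ denotes the closed neighborhood of $v$ and $\Delta$ symmetric difference. A set $S \subseteq V(T)$ is a redundant identifying code if every vertex $v$ satisfies $|N[v] \cap S| \ge 2$ and every pair of distinct vertices $u,v$ satisfies $|(N[u]\cap S)\,\Delta\,(N[v]\cap S)| \ge 2$; $\mathrm{RED{:}IC}(T)$ is the minimum cardinality of such a set. A vertex $u$ with exactly one neighbor $v$ is a leaf, and $v$ is then a support vertex. *)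

theory Defs
  imports "Graph_Theory.Graph_Theory"
begin

text \<open>Finite simple undirected graphs are the library's \<^locale>\<open>pair_graph\<close>s: finite, loop-free
  digraphs with a symmetric set of arcs.\<close>

definition nbhd :: "'a pair_pre_digraph \<Rightarrow> 'a \<Rightarrow> 'a set" where
  "nbhd G v = {u. (v, u) \<in> parcs G}"

definition closed_nbhd :: "'a pair_pre_digraph \<Rightarrow> 'a \<Rightarrow> 'a set" where
  "closed_nbhd G v = insert v (nbhd G v)"

text \<open>The arcs are symmetric, so each undirected edge at a vertex contributes exactly one outgoing
  arc and the out-degree is the undirected degree.\<close>

abbreviation deg :: "'a pair_pre_digraph \<Rightarrow> 'a \<Rightarrow> nat" where
  "deg G v \<equiv> out_degree (with_proj G) v"

lemma deg_eq_card_nbhd: "deg G v = card (nbhd G v)"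
proof -
  have "out_arcs (with_proj G) v = Pair v ` nbhd G v"
    by (auto simp: out_arcs_def nbhd_def)
  then show ?thesis
    by (simp add: out_degree_def card_image inj_on_def)
qed

text \<open>The library's predicate for trees cannot be used: in a symmetric digraph every edge, run
  through back and forth, is a directed cycle of length 2. In a loop-free symmetric digraph the
  cycles of the underlying undirected graph are those of length at least 3. Connectedness includes
  that there is at least one vertex.\<close>

definition undirected_tree :: "'a pair_pre_digraph \<Rightarrow> bool" where
  "undirected_tree G \<longleftrightarrow>
     pair_graph G \<and> connected (with_proj G) \<and>
     \<not> (\<exists>p. pre_digraph.cycle (with_proj G) p \<and> length p \<ge> 3)"

definition leaf :: "'a pair_pre_digraph \<Rightarrow> 'a \<Rightarrow> bool" where
  "leaf G u \<longleftrightarrow> (\<exists>v. nbhd G u = {v})"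

definition support_vertex :: "'a pair_pre_digraph \<Rightarrow> 'a \<Rightarrow> bool" where
  "support_vertex G v \<longleftrightarrow> (\<exists>u. nbhd G u = {v})"

definition sym_diff :: "'a set \<Rightarrow> 'a set \<Rightarrow> 'a set" where
  "sym_diff A B = (A - B) \<union> (B - A)"

definition redundant_identifying_code :: "'a pair_pre_digraph \<Rightarrow> 'a set \<Rightarrow> bool" where
  "redundant_identifying_code G S \<longleftrightarrow>
     S \<subseteq> pverts G \<and>
     (\<forall>v \<in> pverts G. card (closed_nbhd G v \<inter> S) \<ge> 2) \<and>
     (\<forall>u \<in> pverts G. \<forall>v \<in> pverts G. u \<noteq> v \<longrightarrow>
        card (sym_diff (closed_nbhd G u \<inter> S) (closed_nbhd G v \<inter> S)) \<ge> 2)"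

text \<open>Only meaningful when \<open>G\<close> has a redundant identifying code.\<close>

definition RED_IC :: "'a pair_pre_digraph \<Rightarrow> nat" where
  "RED_IC G = (LEAST k. \<exists>S. redundant_identifying_code G S \<and> card S = k)"

end

theory Submission
  imports Defs
begin

text \<open>Enlarging a redundant identifying code keeps the property, so \<open>RED_IC T = n\<close> means that no
  single vertex can be left out of the full vertex set. Leaving out \<open>v\<close> fails exactly if \<open>v\<close> lies in
  a closed neighborhood of size 2, which makes \<open>v\<close> a leaf or a support vertex, or in a symmetric
  difference \<open>N[x] \<Delta> N[y]\<close> of size 2. As there are no triangles and no 4-cycles, the latter forces
  \<open>x\<close> and \<open>y\<close> to be two leaves at distance 2, a leaf with its support vertex of degree 3, or two
  adjacent vertices of degree 2.\<close>

section \<open>Neighborhoods and short cycles in a tree\<close>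

lemma sym_diff_commute: "sym_diff A B = sym_diff B A"
  by (auto simp: sym_diff_def)

lemma sym_diff_Int: "sym_diff (A \<inter> S) (B \<inter> S) = sym_diff A B \<inter> S"
  by (auto simp: sym_diff_def)

lemma undirected_treeD:
  assumes "undirected_tree G"
  shows finite_pverts: "finite (pverts G)"
    and nbhd_subset: "nbhd G v \<subseteq> pverts G"
    and nbhd_sym: "u \<in> nbhd G v \<Longrightarrow> v \<in> nbhd G u"
    and nbhd_irrefl: "v \<notin> nbhd G v"
    and nbhd_nonempty_in_pverts: "u \<in> nbhd G v \<Longrightarrow> v \<in> pverts G"
proof -
  interpret pair_graph G
    using assms by (simp add: undirected_tree_def)
  show "finite (pverts G)" by simp
  show "nbhd G v \<subseteq> pverts G"
    by (auto simp: nbhd_def dest: in_arcsD2)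
  show "u \<in> nbhd G v \<Longrightarrow> v \<in> nbhd G u"
    using arcs_symmetric by (auto simp: nbhd_def)
  show "v \<notin> nbhd G v"
    using no_loops by (force simp: nbhd_def)
  show "u \<in> nbhd G v \<Longrightarrow> v \<in> pverts G"
    by (auto simp: nbhd_def dest: in_arcsD1)
qed

lemma tree_triangle_free:
  assumes T: "undirected_tree G" and e: "b \<in> nbhd G a" "c \<in> nbhd G b"
  shows "a \<notin> nbhd G c"
proof
  assume a: "a \<in> nbhd G c"
  have d: "a \<noteq> b" "b \<noteq> c" "c \<noteq> a"
    using e a nbhd_irrefl[OF T] by metis+
  \<comment> \<open>A walk must start at a vertex of the graph, so \<open>V\<close> is part of
    exhibiting the triangle as a cycle.\<close>
  have V: "a \<in> pverts G"
    using e nbhd_nonempty_in_pverts[OF T] by metis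
  have "pre_digraph.cycle (with_proj G) [(a, b), (b, c), (c, a)]"
    unfolding pre_digraph.cycle_def
    using e a d V
    by (auto simp: pre_digraph.awalk_def pre_digraph.cas.simps pre_digraph.awalk_verts.simps nbhd_def)
  then show False
    using T by (force simp: undirected_tree_def)
qed

text \<open>Two different common neighbors of \<open>a\<close> and \<open>c\<close> would close up
  to a cycle of length 4.\<close>

lemma tree_common_nbhd_unique:
  assumes T: "undirected_tree G" and "a \<noteq> c"
    and e: "b \<in> nbhd G a" "b \<in> nbhd G c" "d \<in> nbhd G a" "d \<in> nbhd G c"
  shows "b = d"
proof (rule ccontr)
  assume "b \<noteq> d"
  have d: "a \<noteq> b" "b \<noteq> c" "a \<noteq> d" "c \<noteq> d"
    using e nbhd_irrefl[OF T] by metis+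
  have V: "a \<in> pverts G"
    using e nbhd_nonempty_in_pverts[OF T] by metis
  have "pre_digraph.cycle (with_proj G) [(a, b), (b, c), (c, d), (d, a)]"
    unfolding pre_digraph.cycle_def
    using e(1,4) nbhd_sym[OF T e(2)] nbhd_sym[OF T e(3)] d V \<open>a \<noteq> c\<close> \<open>b \<noteq> d\<close>
    by (auto simp: pre_digraph.awalk_def pre_digraph.cas.simps pre_digraph.awalk_verts.simps nbhd_def)
  then show False
    using T by (force simp: undirected_tree_def)
qed

lemma finite_nbhd: "undirected_tree G \<Longrightarrow> finite (nbhd G v)"
  using finite_pverts nbhd_subset finite_subset by metis

lemma finite_closed_nbhd: "undirected_tree G \<Longrightarrow> finite (closed_nbhd G v)"
  by (simp add: closed_nbhd_def finite_nbhd)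

lemma finite_sym_diff_closed_nbhd:
  "undirected_tree G \<Longrightarrow> finite (sym_diff (closed_nbhd G u) (closed_nbhd G v))"
  by (simp add: sym_diff_def finite_closed_nbhd)

lemma card_closed_nbhd: "undirected_tree G \<Longrightarrow> card (closed_nbhd G v) = Suc (deg G v)"
  by (simp add: closed_nbhd_def finite_nbhd nbhd_irrefl deg_eq_card_nbhd)

section \<open>Monotonicity of codes and removal of one vertex\<close>

lemma redundant_identifying_code_mono:
  assumes T: "undirected_tree G" and S: "redundant_identifying_code G S"
    and "S \<subseteq> S'" "S' \<subseteq> pverts G"
  shows "redundant_identifying_code G S'"
proof -
  \<comment> \<open>By \<open>sym_diff_Int\<close>, every condition on a code \<open>S\<close> is a
    lower bound on \<open>card (X \<inter> S)\<close> for a finite set \<open>X\<close> that does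
    not depend on \<open>S\<close>.\<close>
  have mono: "2 \<le> card (X \<inter> S')" if "finite X" "2 \<le> card (X \<inter> S)" for X
    using that \<open>S \<subseteq> S'\<close> card_mono[of "X \<inter> S'" "X \<inter> S"] by fastforce
  show ?thesis
    using S \<open>S' \<subseteq> pverts G\<close>
    unfolding redundant_identifying_code_def sym_diff_Int
    by (auto intro!: mono finite_closed_nbhd[OF T] finite_sym_diff_closed_nbhd[OF T])
qed

lemma redundant_identifying_code_pverts_iff:
  assumes T: "undirected_tree G"
  shows "redundant_identifying_code G (pverts G) \<longleftrightarrow>
     (\<forall>x \<in> pverts G. card (closed_nbhd G x) \<ge> 2) \<and>
     (\<forall>x \<in> pverts G. \<forall>y \<in> pverts G. x \<noteq> y \<longrightarrow>
        card (sym_diff (closed_nbhd G x) (closed_nbhd G y)) \<ge> 2)"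
proof -
  have "closed_nbhd G x \<inter> pverts G = closed_nbhd G x" if "x \<in> pverts G" for x
    using that nbhd_subset[OF T, of x] by (auto simp: closed_nbhd_def)
  then show ?thesis
    by (auto simp: redundant_identifying_code_def)
qed

text \<open>Removing \<open>v\<close> costs each relevant set at most one element. All of them have
  at least 2 elements beforehand, so only a set of size exactly 2 that contains \<open>v\<close> can
  become too small.\<close>

lemma redundant_identifying_code_remove_iff:
  assumes T: "undirected_tree G" and V: "redundant_identifying_code G (pverts G)"
  shows "redundant_identifying_code G (pverts G - {v}) \<longleftrightarrow>
     (\<forall>x \<in> pverts G. v \<in> closed_nbhd G x \<longrightarrow> card (closed_nbhd G x) \<noteq> 2) \<and>
     (\<forall>x \<in> pverts G. \<forall>y \<in> pverts G. x \<noteq> y \<longrightarrow>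
        v \<in> sym_diff (closed_nbhd G x) (closed_nbhd G y) \<longrightarrow>
        card (sym_diff (closed_nbhd G x) (closed_nbhd G y)) \<noteq> 2)"
proof -
  have sub: "closed_nbhd G x \<subseteq> pverts G" if "x \<in> pverts G" for x
    using that nbhd_subset[OF T, of x] by (auto simp: closed_nbhd_def)
  have sub2: "sym_diff (closed_nbhd G x) (closed_nbhd G y) \<subseteq> pverts G"
    if "x \<in> pverts G" "y \<in> pverts G" for x y
    using sub that by (auto simp: sym_diff_def)
  have rem: "2 \<le> card (X \<inter> (pverts G - {v})) \<longleftrightarrow> (v \<in> X \<longrightarrow> card X \<noteq> 2)"
    if "X \<subseteq> pverts G" "2 \<le> card X" for X
  proof -
    have "X \<inter> (pverts G - {v}) = X - {v}"
      using that by auto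
    then show ?thesis
      using that finite_subset[OF that(1) finite_pverts[OF T]] by (auto simp: card_Diff_singleton_if)
  qed
  show ?thesis
    using V unfolding redundant_identifying_code_pverts_iff[OF T]
    by (auto simp: redundant_identifying_code_def sym_diff_Int rem sub sub2)
qed

text \<open>A minimum code that misses some vertex \<open>v\<close> grows by monotonicity to the
  code \<open>pverts G - {v}\<close>, so it is enough to test the removal of single
  vertices.\<close>

lemma RED_IC_eq_card_iff:
  assumes T: "undirected_tree G" and ex: "\<exists>S. redundant_identifying_code G S"
  shows "RED_IC G = card (pverts G) \<longleftrightarrow>
    (\<forall>v \<in> pverts G. \<not> redundant_identifying_code G (pverts G - {v}))"
proof
  assume eq: "RED_IC G = card (pverts G)"
  show "\<forall>v \<in> pverts G. \<not> redundant_identifying_code G (pverts G - {v})"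
  proof (intro ballI notI)
    fix v
    assume v: "v \<in> pverts G" and "redundant_identifying_code G (pverts G - {v})"
    then have "RED_IC G \<le> card (pverts G - {v})"
      unfolding RED_IC_def by (blast intro: Least_le)
    then show False
      using eq card_Diff1_less[OF finite_pverts[OF T] v] by simp
  qed
next
  assume crit: "\<forall>v \<in> pverts G. \<not> redundant_identifying_code G (pverts G - {v})"
  \<comment> \<open>The minimum is attained because some code exists.\<close>
  have "\<exists>S. redundant_identifying_code G S \<and> card S = RED_IC G"
    unfolding RED_IC_def using ex by (rule_tac LeastI_ex) blast
  then obtain S where S: "redundant_identifying_code G S" "card S = RED_IC G"
    by blast
  have "S \<subseteq> pverts G"
    using S by (simp add: redundant_identifying_code_def)
  moreover have "v \<in> S" if "v \<in> pverts G" for v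
  proof (rule ccontr)
    assume "v \<notin> S"
    then have "redundant_identifying_code G (pverts G - {v})"
      using \<open>S \<subseteq> pverts G\<close> by (intro redundant_identifying_code_mono[OF T S(1)]) auto
    then show False
      using crit that by blast
  qed
  ultimately show "RED_IC G = card (pverts G)"
    using S by (metis subsetI subset_antisym)
qed

section \<open>Closed neighborhoods and symmetric differences of size 2\<close>

lemma leaf_or_support_iff:
  assumes T: "undirected_tree G" and v: "v \<in> pverts G"
  shows "leaf G v \<or> support_vertex G v \<longleftrightarrow>
    (\<exists>x \<in> pverts G. v \<in> closed_nbhd G x \<and> card (closed_nbhd G x) = 2)"
proof -
  \<comment> \<open>A closed neighborhood of size 2 consists of a leaf and its support vertex, so
    \<open>v\<close> is one of these.\<close>
  have "card (closed_nbhd G x) = 2 \<longleftrightarrow> (\<exists>u. nbhd G x = {u})" for x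
    by (simp add: card_closed_nbhd[OF T] deg_eq_card_nbhd card_1_singleton_iff)
  moreover have "x \<in> pverts G" if "nbhd G x = {u}" for x u
    using that nbhd_nonempty_in_pverts[OF T, of u x] by simp
  ultimately show ?thesis
    using v unfolding leaf_def support_vertex_def closed_nbhd_def by auto
qed

text \<open>If \<open>x\<close> and \<open>y\<close> are adjacent, both cancel in the difference and
  only their other neighbors are counted. If not, \<open>x\<close> and \<open>y\<close> alone fill
  the difference, so all neighbors of \<open>x\<close> are shared with \<open>y\<close>.\<close>

lemma small_sym_diff_cases:
  assumes T: "undirected_tree G" and V: "redundant_identifying_code G (pverts G)"
    and xy: "x \<in> pverts G" "y \<in> pverts G" "x \<noteq> y"
    and v: "v \<in> closed_nbhd G x" "v \<notin> closed_nbhd G y"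
    and two: "card (sym_diff (closed_nbhd G x) (closed_nbhd G y)) = 2"
  shows "leaf G v \<or>
       (\<exists>s \<in> nbhd G v. support_vertex G s \<and> deg G s = 3) \<or>
       (\<exists>w \<in> nbhd G v. \<exists>u \<in> nbhd G w. u \<noteq> v \<and> deg G w = 2 \<and> deg G u = 2)"
proof (cases "y \<in> nbhd G x")
  case True
  then have yx: "x \<in> nbhd G y"
    by (rule nbhd_sym[OF T])
  \<comment> \<open>Both \<open>x\<close> and \<open>y\<close> lie in the closed neighborhood of
    \<open>y\<close>, which omits \<open>v\<close>.\<close>
  have "v \<noteq> x" "v \<noteq> y"
    using v yx by (auto simp: closed_nbhd_def)
  then have vx: "v \<in> nbhd G x - {y}"
    using v by (simp add: closed_nbhd_def)
  then have xv: "x \<in> nbhd G v"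
    using nbhd_sym[OF T] by simp
  have disj: "nbhd G x \<inter> nbhd G y = {}"
    using tree_triangle_free[OF T True] nbhd_sym[OF T] by blast
  then have "sym_diff (closed_nbhd G x) (closed_nbhd G y) = (nbhd G x - {y}) \<union> (nbhd G y - {x})"
    using True yx nbhd_irrefl[OF T] by (auto simp: sym_diff_def closed_nbhd_def)
  also have "card \<dots> = card (nbhd G x - {y}) + card (nbhd G y - {x})"
    using disj by (intro card_Un_disjoint) (auto simp: finite_nbhd[OF T])
  finally have sum: "card (nbhd G x - {y}) + card (nbhd G y - {x}) = 2"
    using two by simp
  have dx: "deg G x = Suc (card (nbhd G x - {y}))" and dy: "deg G y = Suc (card (nbhd G y - {x}))"
    using card_Suc_Diff1[OF finite_nbhd[OF T] True] card_Suc_Diff1[OF finite_nbhd[OF T] yx]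
    by (simp_all add: deg_eq_card_nbhd)
  \<comment> \<open>Since \<open>v\<close> is counted on the side of \<open>x\<close>, the sum 2
    splits as 1 + 1 or 2 + 0; the edge between \<open>x\<close> and \<open>y\<close> adds one to
    each degree.\<close>
  have "card (nbhd G x - {y}) > 0"
    using vx finite_nbhd[OF T] by (auto simp: card_gt_0_iff)
  then consider "deg G x = 2" "deg G y = 2" | "deg G x = 3" "card (nbhd G y - {x}) = 0"
    using sum dx dy by linarith
  then show ?thesis
  proof cases
    case 1
    then have "\<exists>w \<in> nbhd G v. \<exists>u \<in> nbhd G w. u \<noteq> v \<and> deg G w = 2 \<and> deg G u = 2"
      using \<open>v \<noteq> y\<close> by (intro bexI[OF _ xv] bexI[OF _ True]) simp
    then show ?thesis
      by blast
  next
    case 2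
    \<comment> \<open>In the split 2 + 0, \<open>y\<close> is a leaf at \<open>x\<close>, which
      makes \<open>x\<close> the support vertex of degree 3.\<close>
    then have "nbhd G y - {x} = {}"
      by (simp only: card_0_eq finite_Diff finite_nbhd[OF T])
    then have "nbhd G y = {x}"
      using yx by blast
    then show ?thesis
      using 2 xv by (auto simp: support_vertex_def)
  qed
next
  case False
  then have "x \<notin> nbhd G y"
    using nbhd_sym[OF T] by blast
  let ?D = "sym_diff (closed_nbhd G x) (closed_nbhd G y)"
  have "{x, y} \<subseteq> ?D"
    using False \<open>x \<notin> nbhd G y\<close> \<open>x \<noteq> y\<close> by (auto simp: sym_diff_def closed_nbhd_def)
  then have D: "?D = {x, y}"
    using two \<open>x \<noteq> y\<close> card_subset_eq[OF finite_sym_diff_closed_nbhd[OF T] \<open>{x, y} \<subseteq> ?D\<close>] by simp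
  then have "v = x"
    using v by (auto simp: sym_diff_def closed_nbhd_def)
  have "nbhd G x \<subseteq> nbhd G y"
  proof
    fix z
    assume z: "z \<in> nbhd G x"
    then have "z \<noteq> x" "z \<noteq> y"
      using False nbhd_irrefl[OF T, of x] by auto
    then have "z \<notin> ?D"
      by (simp only: D) simp
    then show "z \<in> nbhd G y"
      using z \<open>z \<noteq> y\<close> by (simp add: sym_diff_def closed_nbhd_def)
  qed
  moreover have "nbhd G x \<noteq> {}"
    using V xy(1) by (auto simp: redundant_identifying_code_pverts_iff[OF T] closed_nbhd_def)
  \<comment> \<open>All neighbors of \<open>x\<close> are common to \<open>x\<close> and
    \<open>y\<close>, and without 4-cycles there is only one such vertex.\<close>
  ultimately have "\<exists>u. nbhd G x = {u}"
    using tree_common_nbhd_unique[OF T \<open>x \<noteq> y\<close>] by blast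
  then show ?thesis
    using \<open>v = x\<close> by (simp add: leaf_def)
qed

text \<open>For a leaf \<open>l\<close> at \<open>s\<close>, the closed neighborhood of
  \<open>l\<close> lies inside that of \<open>s\<close>, and the difference is the two neighbors of
  \<open>s\<close> other than \<open>l\<close>. As \<open>v\<close> is not a leaf, it is one of
  them.\<close>

lemma small_sym_diff_support:
  assumes T: "undirected_tree G" and s: "s \<in> nbhd G v" "support_vertex G s" "deg G s = 3"
    and "\<not> leaf G v"
  obtains l where "l \<in> pverts G" "s \<noteq> l" "v \<in> sym_diff (closed_nbhd G s) (closed_nbhd G l)"
    "card (sym_diff (closed_nbhd G s) (closed_nbhd G l)) = 2"
proof -
  obtain l where l: "nbhd G l = {s}"
    using s(2) by (auto simp: support_vertex_def)
  have "v \<noteq> l"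
    using \<open>\<not> leaf G v\<close> l by (auto simp: leaf_def)
  have ls: "l \<in> nbhd G s" and vs: "v \<in> nbhd G s"
    using l nbhd_sym[OF T s(1)] nbhd_sym[OF T, of s l] by simp_all
  have D: "sym_diff (closed_nbhd G s) (closed_nbhd G l) = nbhd G s - {l}"
    using l ls nbhd_irrefl[OF T, of s] by (auto simp: sym_diff_def closed_nbhd_def)
  show thesis
  proof (rule that)
    show "l \<in> pverts G"
      using ls nbhd_subset[OF T] by blast
    show "s \<noteq> l"
      using ls nbhd_irrefl[OF T] by blast
    show "v \<in> sym_diff (closed_nbhd G s) (closed_nbhd G l)"
      using vs \<open>v \<noteq> l\<close> D by simp
    show "card (sym_diff (closed_nbhd G s) (closed_nbhd G l)) = 2"
      using s(3) ls D by (simp add: deg_eq_card_nbhd finite_nbhd[OF T])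
  qed
qed

text \<open>The adjacent vertices \<open>w\<close> and \<open>u\<close> cancel, which leaves one
  further neighbor of each: \<open>v\<close> for \<open>w\<close> and some \<open>z\<close> for
  \<open>u\<close>.\<close>

lemma small_sym_diff_path:
  assumes T: "undirected_tree G" and e: "w \<in> nbhd G v" "u \<in> nbhd G w" "u \<noteq> v"
    and dw: "deg G w = 2" and du: "deg G u = 2"
  shows "v \<in> sym_diff (closed_nbhd G w) (closed_nbhd G u)"
    and "card (sym_diff (closed_nbhd G w) (closed_nbhd G u)) = 2"
proof -
  have vw: "v \<in> nbhd G w" and wu: "w \<in> nbhd G u"
    using nbhd_sym[OF T e(1)] nbhd_sym[OF T e(2)] by simp_all
  have w: "nbhd G w = {v, u}"
    using card_subset_eq[OF finite_nbhd[OF T], of "{v, u}" w] dw vw e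
    by (auto simp: deg_eq_card_nbhd)
  have "card (nbhd G u - {w}) = 1"
    using du wu by (simp add: deg_eq_card_nbhd finite_nbhd[OF T])
  then obtain z where "nbhd G u - {w} = {z}"
    by (rule card_1_singletonE)
  then have z: "z \<noteq> w" "nbhd G u = {w, z}"
    using wu by blast+
  \<comment> \<open>If \<open>z\<close> were \<open>v\<close>, then \<open>v\<close>,
    \<open>w\<close>, \<open>u\<close> would form a triangle.\<close>
  have "z \<noteq> v" "z \<noteq> u" "u \<noteq> w" "v \<noteq> w"
    using tree_triangle_free[OF T e(1,2)] nbhd_irrefl[OF T] z vw wu by auto
  then have "sym_diff (closed_nbhd G w) (closed_nbhd G u) = {v, z}"
    using w z e(3) by (auto simp: sym_diff_def closed_nbhd_def)
  then show "v \<in> sym_diff (closed_nbhd G w) (closed_nbhd G u)"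
    and "card (sym_diff (closed_nbhd G w) (closed_nbhd G u)) = 2"
    using \<open>z \<noteq> v\<close> by auto
qed

section \<open>Vertices that cannot be removed and the four conditions\<close>

theorem theorem6:
  fixes T :: "'a pair_pre_digraph"
  assumes "undirected_tree T"
    and "card (pverts T) \<ge> 4"
    and "\<exists>S. redundant_identifying_code T S"
  shows "RED_IC T = card (pverts T) \<longleftrightarrow>
    (\<forall>v \<in> pverts T.
       leaf T v \<or>
       support_vertex T v \<or>
       (\<exists>s \<in> nbhd T v. support_vertex T s \<and> deg T s = 3) \<or>
       (\<exists>w \<in> nbhd T v. \<exists>u \<in> nbhd T w. u \<noteq> v \<and> deg T w = 2 \<and> deg T u = 2))"
proof -
  note T = assms(1)
  \<comment> \<open>Any code can be enlarged to the full vertex set.\<close>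
  have V: "redundant_identifying_code T (pverts T)"
    using assms(3) redundant_identifying_code_mono[OF T]
    by (metis redundant_identifying_code_def subset_refl)
  have "\<not> redundant_identifying_code T (pverts T - {v}) \<longleftrightarrow>
       leaf T v \<or>
       support_vertex T v \<or>
       (\<exists>s \<in> nbhd T v. support_vertex T s \<and> deg T s = 3) \<or>
       (\<exists>w \<in> nbhd T v. \<exists>u \<in> nbhd T w. u \<noteq> v \<and> deg T w = 2 \<and> deg T u = 2)"
    (is "?L \<longleftrightarrow> ?R") if v: "v \<in> pverts T" for v
  proof -
    let ?D = "\<lambda>x y. sym_diff (closed_nbhd T x) (closed_nbhd T y)"
    have L: "?L \<longleftrightarrow> leaf T v \<or> support_vertex T v \<or>
        (\<exists>x \<in> pverts T. \<exists>y \<in> pverts T. x \<noteq> y \<and> v \<in> ?D x y \<and> card (?D x y) = 2)"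
      using leaf_or_support_iff[OF T v] redundant_identifying_code_remove_iff[OF T V] by blast
    show ?thesis
    proof
      assume ?L
      then consider "leaf T v \<or> support_vertex T v"
        | x y where "x \<in> pverts T" "y \<in> pverts T" "x \<noteq> y" "v \<in> ?D x y" "card (?D x y) = 2"
        using L by blast
      then show ?R
      proof cases
        case (2 x y)
        from 2(4) consider "v \<in> closed_nbhd T x" "v \<notin> closed_nbhd T y"
          | "v \<in> closed_nbhd T y" "v \<notin> closed_nbhd T x"
          by (auto simp: sym_diff_def)
        then show ?thesis
        proof cases
          case 1
          show ?thesis
            using small_sym_diff_cases[OF T V 2(1,2,3) 1 2(5)] by blast
        next
          \<comment> \<open>Here \<open>v\<close> lies on the side of \<open>y\<close>, so
            \<open>small_sym_diff_cases\<close> is used with \<open>x\<close> and \<open>y\<close>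
            exchanged.\<close>
          case swapped: 2
          show ?thesis
            using small_sym_diff_cases[OF T V 2(2,1) 2(3)[symmetric] swapped]
              2(5) sym_diff_commute[of "closed_nbhd T x"] by auto
        qed
      qed blast
    next
      assume ?R
      then consider "leaf T v \<or> support_vertex T v"
        \<comment> \<open>A leaf \<open>v\<close> is covered by the first case; excluding it here
          ensures that \<open>v\<close> differs from the leaf chosen at \<open>s\<close>.\<close>
        | s where "\<not> leaf T v" "s \<in> nbhd T v" "support_vertex T s" "deg T s = 3"
        | w u where "w \<in> nbhd T v" "u \<in> nbhd T w" "u \<noteq> v" "deg T w = 2" "deg T u = 2"
        by blast
      then show ?L
      proof cases
        case 1
        then show ?thesis
          using L by blast
      next
        case (2 s)
        then obtain l where "l \<in> pverts T" "s \<noteq> l" "v \<in> ?D s l" "card (?D s l) = 2"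
          using small_sym_diff_support[OF T 2(2-4,1)] by blast
        moreover have "s \<in> pverts T"
          using 2 nbhd_subset[OF T] by blast
        ultimately show ?thesis
          using L by blast
      next
        case (3 w u)
        have "w \<in> pverts T" "u \<in> pverts T" "w \<noteq> u"
          using 3 nbhd_subset[OF T] nbhd_irrefl[OF T] by blast+
        then show ?thesis
          using L small_sym_diff_path[OF T 3] by blast
      qed
    qed
  qed
  then show ?thesis
    unfolding RED_IC_eq_card_iff[OF T assms(3)] by blast
qed

end
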